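(* Let $I\subset[X]$ be a monoid ideal and let $m\in[X]$. Let $\Delta_m=\Delta_m(I)$ be the simplicial complex of finite subsets of $\mathbb{N}^+$ given by $$\sigma=\{\sigma_1,\dots,\sigma_r\}\in\Delta_m\iff \frac{m}{\prod_{i=1}^r x_{\sigma_i}}\in I$$ (in particular $\prod_i x_{\sigma_i}$ divides $m$). Then $\Delta_m$ is finite, and the coefficient $[m]p(I)$ of $m$ in $p(I)$ satisfies $$[m]p(I)=\tilde\chi(\Delta_m(I))=\sum_{F\in\Delta_m(I)}(-1)^{|F|-1}=\sum_{i=-1}^{\infty}(-1)^i\dim_K \tilde H_i(\Delta_m,K).$$
   Context: $K$ is a field containing $\mathbb{Q}$. $X=\{x_1,x_2,\dots\}$ is a countable set of indeterminates; $[X]$ is the free abelian monoid of monomials in $X$. A monoid ideal is a subset $I\subset[X]$ with $[X]I\subset I$. $\mathbb{Z}[[X]]$ is the ring of all formal sums $\sum_{m\in[X]}c_m m$, $c_m\in\mathbb{Z}$, with convolution product, and $p(I)=\mu\cdot\sum_{m\in[X]\setminus I}m$, where $\mu=\prod_{i\ge1}(1-x_i)$. $\tilde\chi$ is the reduced Euler characteristic of an abstract simplicial complex, counting the empty set as a face of dimension $-1$; $|F|$ is the cardinality of the face $F$; $\tilde H_i$ is reduced simplicial homology.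
   Formalization: The equality of [m]p(I) with the reduced Euler characteristic is stated only for m ≠ 1, since at m = 1 it fails for every monoid ideal I (the two sides always differ by 1); all other claims are stated for every m. *)

theory Defs
  imports
    "HOL-Analysis.Infinite_Sum"
    "HOL-Algebra.AbelCoset"
    "Jordan_Normal_Form.VS_Connect"
begin

section \<open>Monomials and formal sums of monomials\<close>

text \<open>
  The free abelian monoid on the indeterminates is the type \<^typ>\<open>nat multiset\<close>, written
  additively: \<^term>\<open>{#}\<close> is the monomial 1 and \<^term>\<open>a + b\<close> is the product of \<^term>\<open>a\<close> and
  \<^term>\<open>b\<close>. The indices are shifted by one: the natural number \<^term>\<open>i\<close> stands for the
  positive integer \<^term>\<open>i + 1\<close>, so that the singleton \<^term>\<open>{#i#}\<close> is the indeterminate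
  numbered \<^term>\<open>i + 1\<close>. The shift preserves the order used to orient simplices.
\<close>

definition monoid_ideal :: "nat multiset set \<Rightarrow> bool" where
  "monoid_ideal I \<longleftrightarrow> (\<forall>a. \<forall>m\<in>I. a + m \<in> I)"

typedef zseries = "UNIV :: (nat multiset \<Rightarrow> int) set"
  morphisms mcoeff Abs_zseries by simp

lemma mcoeff_Abs [simp]: "mcoeff (Abs_zseries f) = f"
  by (simp add: Abs_zseries_inverse)

lemma zseries_eqI: "(\<And>m. mcoeff f m = mcoeff g m) \<Longrightarrow> f = g"
  by (metis ext mcoeff_inject)

lemma finite_submultisets: "finite {a. a \<subseteq># (m :: 'a multiset)}"
proof (induction m)
  case empty
  then show ?case by simp
next
  case (add x m)
  have "{a. a \<subseteq># add_mset x m} \<subseteq> {a. a \<subseteq># m} \<union> add_mset x ` {a. a \<subseteq># m}"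
  proof
    fix a assume "a \<in> {a. a \<subseteq># add_mset x m}"
    then have a: "a \<subseteq># add_mset x m" by simp
    show "a \<in> {a. a \<subseteq># m} \<union> add_mset x ` {a. a \<subseteq># m}"
    proof (cases "x \<in># a")
      case True
      then obtain b where "a = add_mset x b" by (meson multi_member_split)
      with a show ?thesis by auto
    next
      case False
      with a have "a \<subseteq># m"
        by (metis diff_single_trivial subset_eq_diff_conv add_mset_add_single)
      then show ?thesis by simp
    qed
  qed
  with add show ?case by (meson finite_UnI finite_imageI finite_subset)
qed

lemma finite_factorizations [simp]: "finite {(a, b). a + b = (m :: 'a multiset)}"
proof (rule finite_subset)
  show "{(a, b). a + b = m} \<subseteq> {a. a \<subseteq># m} \<times> {b. b \<subseteq># m}" by auto
  show "finite ({a. a \<subseteq># m} \<times> {b. b \<subseteq># m})" by (simp add: finite_submultisets)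
qed

instantiation zseries :: comm_ring_1
begin

definition "0 = Abs_zseries (\<lambda>m. 0)"
definition "1 = Abs_zseries (\<lambda>m. if m = {#} then 1 else 0)"
definition "f + g = Abs_zseries (\<lambda>m. mcoeff f m + mcoeff g m)"
definition "f - g = Abs_zseries (\<lambda>m. mcoeff f m - mcoeff g m)"
definition "- f = Abs_zseries (\<lambda>m. - mcoeff f m)"
definition "f * g = Abs_zseries (\<lambda>m. \<Sum>(a, b) | a + b = m. mcoeff f a * mcoeff g b)"

lemma mcoeff_zero [simp]: "mcoeff 0 m = 0"
  and mcoeff_one: "mcoeff 1 m = (if m = {#} then 1 else 0)"
  and mcoeff_add [simp]: "mcoeff (f + g) m = mcoeff f m + mcoeff g m"
  and mcoeff_diff [simp]: "mcoeff (f - g) m = mcoeff f m - mcoeff g m"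
  and mcoeff_uminus [simp]: "mcoeff (- f) m = - mcoeff f m"
  and mcoeff_mult: "mcoeff (f * g) m = (\<Sum>(a, b) | a + b = m. mcoeff f a * mcoeff g b)"
  by (simp_all add: zero_zseries_def one_zseries_def plus_zseries_def minus_zseries_def
      uminus_zseries_def times_zseries_def)

instance
proof
  fix f g h :: zseries
  show "f * g * h = f * (g * h)"
  proof (rule zseries_eqI)
    fix m
    let ?D = "\<lambda>m :: nat multiset. {(a, b). a + b = m}"
    have "mcoeff (f * g * h) m =
        (\<Sum>x\<in>?D m. \<Sum>y\<in>?D (fst x). mcoeff f (fst y) * mcoeff g (snd y) * mcoeff h (snd x))"
      by (simp add: mcoeff_mult sum_distrib_right case_prod_beta)
    also have "\<dots> = (\<Sum>(x, y)\<in>Sigma (?D m) (\<lambda>x. ?D (fst x)).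
        mcoeff f (fst y) * mcoeff g (snd y) * mcoeff h (snd x))"
      by (rule sum.Sigma) auto
    also have "\<dots> = (\<Sum>(x, y)\<in>Sigma (?D m) (\<lambda>x. ?D (snd x)).
        mcoeff f (fst x) * mcoeff g (fst y) * mcoeff h (snd y))"
      by (rule sum.reindex_bij_witness [where
            i = "\<lambda>((a, q), (b, c)). ((a + b, c), (a, b))" and
            j = "\<lambda>((p, c), (a, b)). ((a, b + c), (b, c))"]) (auto simp: add.assoc)
    also have "\<dots> =
        (\<Sum>x\<in>?D m. \<Sum>y\<in>?D (snd x). mcoeff f (fst x) * mcoeff g (fst y) * mcoeff h (snd y))"
      by (rule sum.Sigma [symmetric]) auto
    also have "\<dots> = mcoeff (f * (g * h)) m"
      by (simp add: mcoeff_mult sum_distrib_left case_prod_beta mult.assoc)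
    finally show "mcoeff (f * g * h) m = mcoeff (f * (g * h)) m" .
  qed
  show "f * g = g * f"
    by (rule zseries_eqI, unfold mcoeff_mult,
        rule sum.reindex_bij_witness [where i = "\<lambda>(a, b). (b, a)" and j = "\<lambda>(a, b). (b, a)"])
      (auto simp: add.commute mult.commute)
  show "1 * f = f"
  proof (rule zseries_eqI)
    fix m
    have "mcoeff (1 * f) m = (\<Sum>(a, b)\<in>{({#}, m)}. mcoeff 1 a * mcoeff f b)"
      unfolding mcoeff_mult by (rule sum.mono_neutral_right) (auto simp: mcoeff_one split: if_splits)
    then show "mcoeff (1 * f) m = mcoeff f m" by (simp add: mcoeff_one)
  qed
  show "(f + g) * h = f * h + g * h"
    by (rule zseries_eqI)
      (simp add: mcoeff_mult case_prod_beta distrib_right sum.distrib)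
  show "(0 :: zseries) \<noteq> 1"
    by (metis mcoeff_zero mcoeff_one zero_neq_one)
qed (rule zseries_eqI; simp)+

end

definition indet :: "nat \<Rightarrow> zseries" where
  "indet i = Abs_zseries (\<lambda>m. if m = {#i#} then 1 else 0)"

text \<open>
  The infinite product is the coefficientwise limit of the finite partial products; the
  coefficients are integers, so each limit is that of an eventually constant sequence.
\<close>

definition mu :: zseries where
  "mu = Abs_zseries (\<lambda>m. lim (\<lambda>n. mcoeff (\<Prod>i<n. 1 - indet i) m))"

lemma mcoeff_partial_product_stable:
  assumes "\<And>i. i \<in># m \<Longrightarrow> i < N" and "N \<le> n"
  shows "mcoeff (\<Prod>i<n. 1 - indet i) m = mcoeff (\<Prod>i<N. 1 - indet i) m"
  using assms(2)
proof (induction n rule: dec_induct)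
  case base
  then show ?case by simp
next
  case (step n)
  have "mcoeff ((\<Prod>i<n. 1 - indet i) * indet n) m = 0"
    unfolding mcoeff_mult
  proof (rule sum.neutral, safe)
    fix a b assume m: "m = a + b"
    have "n \<notin># m" using assms(1) step(1) by (meson leD)
    then have "b \<noteq> {#n#}" using m by auto
    then show "mcoeff (\<Prod>i<n. 1 - indet i) a * mcoeff (indet n) b = 0"
      by (simp add: indet_def)
  qed
  then show ?case using step by (simp add: right_diff_distrib)
qed

lemma mcoeff_partial_product_tendsto_mu:
  "(\<lambda>n. mcoeff (\<Prod>i<n. 1 - indet i) m) \<longlonglongrightarrow> mcoeff mu m"
proof -
  obtain N where "\<forall>i\<in>set_mset m. i < N"
    using finite_nat_set_iff_bounded finite_set_mset by blast
  then have "eventually (\<lambda>n. mcoeff (\<Prod>i<n. 1 - indet i) m =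
      mcoeff (\<Prod>i<N. 1 - indet i) m) sequentially"
    by (intro eventually_sequentiallyI [of N] mcoeff_partial_product_stable) auto
  then have "(\<lambda>n. mcoeff (\<Prod>i<n. 1 - indet i) m) \<longlonglongrightarrow>
      mcoeff (\<Prod>i<N. 1 - indet i) m"
    by (rule tendsto_eventually)
  then have "convergent (\<lambda>n. mcoeff (\<Prod>i<n. 1 - indet i) m)"
    by (rule convergentI)
  then show ?thesis by (simp add: mu_def convergent_LIMSEQ_iff)
qed

definition p_series :: "nat multiset set \<Rightarrow> zseries" where
  "p_series I = mu * Abs_zseries (\<lambda>m. if m \<in> I then 0 else 1)"


section \<open>Simplicial complexes\<close>

definition simplicial_complex :: "nat set set \<Rightarrow> bool" where
  "simplicial_complex \<Delta> \<longleftrightarrow> (\<forall>\<sigma>\<in>\<Delta>. finite \<sigma> \<and> (\<forall>\<tau>. \<tau> \<subseteq> \<sigma> \<longrightarrow> \<tau> \<in> \<Delta>))"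

text \<open>
  A simplicial complex may be empty (the void complex, without even the empty face).
  \<^term>\<open>mset_set \<sigma>\<close> is the squarefree monomial with support \<^term>\<open>\<sigma>\<close>. Subtraction of multisets
  truncates, so divisibility is required explicitly.
\<close>

definition Delta :: "nat multiset set \<Rightarrow> nat multiset \<Rightarrow> nat set set" where
  "Delta I m = {\<sigma>. finite \<sigma> \<and> mset_set \<sigma> \<subseteq># m \<and> m - mset_set \<sigma> \<in> I}"

lemma simplicial_complex_Delta:
  assumes "monoid_ideal I"
  shows "simplicial_complex (Delta I m)"
  unfolding simplicial_complex_def
proof (intro ballI conjI allI impI)
  fix \<sigma> assume \<sigma>: "\<sigma> \<in> Delta I m"
  then show fin: "finite \<sigma>" by (simp add: Delta_def)
  fix \<tau> assume \<tau>: "\<tau> \<subseteq> \<sigma>"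
  have split: "mset_set \<sigma> = mset_set \<tau> + mset_set (\<sigma> - \<tau>)"
    using mset_set_Union [of \<tau> "\<sigma> - \<tau>"] \<tau> fin finite_subset [OF \<tau> fin]
    by (simp add: Un_absorb1)
  obtain q where q: "m = mset_set \<sigma> + q"
    using \<sigma> unfolding Delta_def by (auto simp: subset_mset.le_iff_add)
  have "m - mset_set \<tau> = mset_set (\<sigma> - \<tau>) + (m - mset_set \<sigma>)"
    unfolding q by (simp add: split add.assoc)
  then have "m - mset_set \<tau> \<in> I"
    using \<sigma> assms unfolding Delta_def monoid_ideal_def by (metis (lifting) mem_Collect_eq)
  moreover have "mset_set \<tau> \<subseteq># m"
    unfolding q split by (simp add: add.assoc)
  ultimately show "\<tau> \<in> Delta I m"
    using fin \<tau> finite_subset by (auto simp: Delta_def)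
qed

definition face_dim :: "nat set \<Rightarrow> int" where
  "face_dim F = int (card F) - 1"

definition faces :: "nat set set \<Rightarrow> int \<Rightarrow> nat set set" where
  "faces \<Delta> i = {F \<in> \<Delta>. face_dim F = i}"

text \<open>The integer \<open>(-1)\<^sup>i\<close> for a possibly negative exponent (the power operator with integer
  exponents is not available on \<^typ>\<open>int\<close>).\<close>

definition neg_one_pow :: "int \<Rightarrow> int" where
  "neg_one_pow i = (if even i then 1 else - 1)"

lemma of_int_neg_one_pow: "(of_int (neg_one_pow i) :: real) = (- 1) powi i"
  by (simp add: neg_one_pow_def power_int_minus_left)

text \<open>The alternating sum of the face numbers, for a finite complex.\<close>

definition reduced_euler_char :: "nat set set \<Rightarrow> int" where
  "reduced_euler_char \<Delta> = (\<Sum>i\<in>face_dim ` \<Delta>. neg_one_pow i * int (card (faces \<Delta> i)))"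

text \<open>
  At the monomial 1 the coefficient of \<^term>\<open>p_series I\<close> and the reduced Euler characteristic
  never agree, so the equality between them can only be stated for the other monomials.
\<close>

lemma mcoeff_p_series_at_one:
  "mcoeff (p_series I) {#} = reduced_euler_char (Delta I {#}) + 1"
proof -
  have mu: "mcoeff mu {#} = 1"
  proof (rule LIMSEQ_unique [OF mcoeff_partial_product_tendsto_mu])
    have "mcoeff (\<Prod>i<n. 1 - indet i) {#} = 1" for n
      using mcoeff_partial_product_stable [of "{#}" 0 n] by (simp add: mcoeff_one)
    then show "(\<lambda>n. mcoeff (\<Prod>i<n. 1 - indet i) {#}) \<longlonglongrightarrow> 1" by simp
  qed
  have "{(a, b). a + b = ({#} :: nat multiset)} = {({#}, {#})}" by auto
  then have "mcoeff (p_series I) {#} = (if {#} \<in> I then 0 else 1)"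
    by (simp add: p_series_def mcoeff_mult mu)
  moreover have "Delta I {#} = (if {#} \<in> I then {{}} else {})"
    by (auto simp: Delta_def mset_set_empty_iff)
  moreover have "faces {{}} (- 1) = {{}}" by (auto simp: faces_def face_dim_def)
  ultimately show ?thesis
    by (simp add: reduced_euler_char_def face_dim_def neg_one_pow_def)
qed


section \<open>Reduced simplicial homology over a field\<close>

text \<open>
  Chains are finitely supported functions on faces, and all structures are modules over the
  field \<open>'k\<close> regarded as the record \<^term>\<open>class_ring :: 'k::field ring\<close>. The empty face is a face
  of dimension \<open>-1\<close>, so this is the augmented chain complex. The ring multiplication and unit
  fields of module records play no role.
\<close>

definition chain_module :: "nat set set \<Rightarrow> int \<Rightarrow> ('k::field, nat set \<Rightarrow> 'k) module" where
  "chain_module \<Delta> i =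
    \<lparr> carrier = {c. finite {\<sigma>. c \<sigma> \<noteq> 0} \<and> {\<sigma>. c \<sigma> \<noteq> 0} \<subseteq> faces \<Delta> i},
      mult = undefined, one = undefined,
      zero = (\<lambda>\<sigma>. 0), add = (\<lambda>c d \<sigma>. c \<sigma> + d \<sigma>),
      smult = (\<lambda>a c \<sigma>. a * c \<sigma>) \<rparr>"

text \<open>
  Simplices are oriented by the order of their vertices: the boundary of the simplex
  \<^term>\<open>\<sigma>\<close> is the sum over its vertices \<^term>\<open>v\<close> of \<open>(-1)\<^sup>j\<close> times \<^term>\<open>\<sigma> - {v}\<close>, where
  \<open>j\<close> is the position of \<^term>\<open>v\<close> in \<^term>\<open>\<sigma>\<close>, counted from 0.
\<close>

definition boundary :: "(nat set \<Rightarrow> 'k::field) \<Rightarrow> nat set \<Rightarrow> 'k" where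
  "boundary c \<tau> = (\<Sum>\<sigma> | c \<sigma> \<noteq> 0. \<Sum>v\<in>\<sigma>.
      if \<sigma> - {v} = \<tau> then (- 1) ^ card {w \<in> \<sigma>. w < v} * c \<sigma> else 0)"

definition cycles :: "nat set set \<Rightarrow> int \<Rightarrow> (nat set \<Rightarrow> 'k::field) set" where
  "cycles \<Delta> i = {c \<in> carrier (chain_module \<Delta> i). boundary c = (\<lambda>\<tau>. 0)}"

definition boundaries :: "nat set set \<Rightarrow> int \<Rightarrow> (nat set \<Rightarrow> 'k::field) set" where
  "boundaries \<Delta> i = boundary ` carrier (chain_module \<Delta> (i + 1))"

definition quotient_module ::
  "('k, 'a) module \<Rightarrow> 'a set \<Rightarrow> ('k, 'a set) module" where
  "quotient_module V W =
    \<lparr> carrier = a_rcosets\<^bsub>V\<^esub> W,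
      mult = undefined, one = undefined,
      zero = W, add = set_add V,
      smult = (\<lambda>a C. \<Union>c\<in>C. W +>\<^bsub>V\<^esub> (a \<odot>\<^bsub>V\<^esub> c)) \<rparr>"

definition reduced_homology ::
  "nat set set \<Rightarrow> int \<Rightarrow> ('k::field, (nat set \<Rightarrow> 'k) set) module" where
  "reduced_homology \<Delta> i =
    quotient_module ((chain_module \<Delta> i)\<lparr>carrier := cycles \<Delta> i\<rparr>) (boundaries \<Delta> i)"

end

theory Submission
  imports Defs
begin

text \<open>
  The coefficient of a monomial \<open>a\<close> in \<open>\<mu>\<close>, the product of all \<open>1 - x\<^sub>i\<close>, is \<open>(-1)\<^sup>r\<close> if \<open>a\<close> is
  a product of \<open>r\<close> distinct indeterminates, and 0 otherwise (\<open>mcoeff_mu\<close>). Multiplying \<open>\<mu>\<close> by the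
  sum of the monomials outside \<open>I\<close>, the coefficient at \<open>m\<close> becomes the sum of \<open>(-1)\<close> to the power
  \<open>card \<sigma>\<close> over the sets \<open>\<sigma>\<close> of variables of \<open>m\<close> for which the quotient of \<open>m\<close> by the product
  over \<open>\<sigma>\<close> is not in \<open>I\<close>; these are the subsets of the support of \<open>m\<close> that are not faces of
  \<open>\<Delta>\<^sub>m\<close> (\<open>mcoeff_p_series\<close>). If \<open>m \<noteq> 1\<close>, the same sum over all subsets of the support vanishes, so
  the coefficient is the negative of the sum over the faces. This is the reduced Euler
  characteristic, because the dimension of a face is one less than its cardinality.

  The last equality is the Euler-Poincare formula for an arbitrary finite complex
  (\<open>euler_poincare\<close>). It is pure linear algebra once the boundary is known to be a linear map
  whose square is zero (\<open>boundary_linear\<close>, \<open>boundary_boundary\<close>): the rank-nullity theorem, applied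
  to the boundary map and to the projection of the cycles onto the homology, expresses each face
  number as a Betti number plus the dimensions of two consecutive spaces of boundaries
  (\<open>dim_reduced_homology\<close>), and the latter cancel in the alternating sum.
\<close>

section \<open>Coefficients of \<open>\<mu>\<close> and \<open>p(I)\<close>\<close>

lemma mcoeff_mult_indet:
  "mcoeff (f * indet i) a = (if i \<in># a then mcoeff f (a - {#i#}) else 0)"
proof -
  have "mcoeff (f * indet i) a =
      (\<Sum>(b, d)\<in>(if i \<in># a then {(a - {#i#}, {#i#})} else {}). mcoeff f b * mcoeff (indet i) d)"
    unfolding mcoeff_mult
    by (rule sum.mono_neutral_right) (auto simp: indet_def split: if_splits)
  then show ?thesis by (simp add: indet_def)
qed

text \<open>
  Expanding the product picks from each factor either \<open>1\<close> or \<open>-x\<^sub>i\<close>, so exactly the squarefree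
  monomials in the first \<open>n\<close> indeterminates survive, with one sign for each variable. A monomial
  \<open>a\<close> is squarefree if and only if it equals \<open>mset_set (set_mset a)\<close>.
\<close>

lemma mcoeff_partial_product:
  "mcoeff (\<Prod>i<n. 1 - indet i) a =
    (if a = mset_set (set_mset a) \<and> set_mset a \<subseteq> {..<n} then (- 1) ^ size a else 0)"
proof (induction n arbitrary: a)
  case 0
  then show ?case by (simp add: mcoeff_one)
next
  case (Suc n)
  let ?P = "\<lambda>n a. a = mset_set (set_mset a) \<and> set_mset a \<subseteq> {..<n}"
  have step: "mcoeff (\<Prod>i<Suc n. 1 - indet i) a = mcoeff (\<Prod>i<n. 1 - indet i) a -
      (if n \<in># a then mcoeff (\<Prod>i<n. 1 - indet i) (a - {#n#}) else 0)"
    by (simp add: right_diff_distrib mcoeff_mult_indet)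
  show ?case
  proof (cases "n \<in># a")
    case False
    then have "set_mset a \<subseteq> {..<Suc n} \<longleftrightarrow> set_mset a \<subseteq> {..<n}"
      by (auto simp: less_Suc_eq)
    with False show ?thesis unfolding step Suc.IH by simp
  next
    case True
    then obtain b where b: "a = add_mset n b" by (meson multi_member_split)
    have "?P (Suc n) a \<longleftrightarrow> ?P n b"
    proof (cases "n \<in># b")
      case True
      \<comment> \<open>Here the indeterminate \<open>n\<close> occurs twice in \<open>a\<close>.\<close>
      then have "count (mset_set (set_mset a)) n < count a n" by (simp add: b)
      then have "a \<noteq> mset_set (set_mset a)" by (metis less_irrefl)
      with True show ?thesis by auto
    next
      case False
      then have "mset_set (set_mset a) = add_mset n (mset_set (set_mset b))" using b by simp
      with False show ?thesis using b by (auto simp: less_Suc_eq)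
    qed
    moreover have "\<not> ?P n a" using True by auto
    ultimately show ?thesis unfolding step Suc.IH by (simp add: b)
  qed
qed

lemma mcoeff_mu:
  "mcoeff mu a = (if a = mset_set (set_mset a) then (- 1) ^ size a else 0)"
proof (rule LIMSEQ_unique [OF mcoeff_partial_product_tendsto_mu tendsto_eventually])
  obtain N where N: "set_mset a \<subseteq> {..<N}"
    using finite_nat_iff_bounded finite_set_mset by blast
  show "\<forall>\<^sub>F n in sequentially. mcoeff (\<Prod>i<n. 1 - indet i) a =
      (if a = mset_set (set_mset a) then (- 1) ^ size a else 0)"
    using N by (intro eventually_sequentiallyI [of N])
      (auto simp: mcoeff_partial_product)
qed

lemma mset_set_subseteq_iff:
  assumes "finite \<sigma>" shows "mset_set \<sigma> \<subseteq># m \<longleftrightarrow> \<sigma> \<subseteq> set_mset m"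
proof
  show "\<sigma> \<subseteq> set_mset m" if "mset_set \<sigma> \<subseteq># m"
    using set_mset_mono [OF that] assms by simp
  show "mset_set \<sigma> \<subseteq># m" if "\<sigma> \<subseteq> set_mset m"
    using subset_imp_msubset_mset_set [OF that finite_set_mset] mset_set_set_mset_msubset
    by (rule subset_mset.order_trans)
qed

lemma finite_Delta: "finite (Delta I m)"
  by (rule finite_subset [of _ "Pow (set_mset m)"]) (auto simp: Delta_def mset_set_subseteq_iff)

text \<open>
  In the convolution product only the factorizations \<open>m = a + b\<close> with \<open>a\<close> squarefree and \<open>b\<close>
  outside the ideal contribute. Such an \<open>a\<close> is the squarefree monomial on a set \<open>\<sigma>\<close> of variables
  of \<open>m\<close>, and \<open>b \<notin> I\<close> says precisely that \<open>\<sigma>\<close> is not a face: the coefficient is the signed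
  count of the non-faces.
\<close>

lemma mcoeff_p_series:
  "mcoeff (p_series I) m = (\<Sum>\<sigma>\<in>Pow (set_mset m) - Delta I m. (- 1) ^ card \<sigma>)"
proof -
  let ?S = "{\<sigma> \<in> Pow (set_mset m). m - mset_set \<sigma> \<notin> I}"
  let ?t = "\<lambda>(a, b). mcoeff mu a * (if b \<in> I then 0 else 1)"
  have fin: "finite \<sigma>" if "\<sigma> \<subseteq> set_mset m" for \<sigma>
    using that by (rule finite_subset) simp
  have inj: "inj_on (\<lambda>\<sigma>. (mset_set \<sigma>, m - mset_set \<sigma>)) ?S"
    using fin by (auto simp: inj_on_def mset_set_eq_iff)
  have "mcoeff (p_series I) m = sum ?t {(a, b). a + b = m}"
    by (simp add: p_series_def mcoeff_mult)
  also have "\<dots> = sum ?t ((\<lambda>\<sigma>. (mset_set \<sigma>, m - mset_set \<sigma>)) ` ?S)"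
  proof (rule sum.mono_neutral_right)
    show "\<forall>x\<in>{(a, b). a + b = m} - (\<lambda>\<sigma>. (mset_set \<sigma>, m - mset_set \<sigma>)) ` ?S. ?t x = 0"
    proof (intro ballI, rule ccontr)
      fix x assume x: "x \<in> {(a, b). a + b = m} - (\<lambda>\<sigma>. (mset_set \<sigma>, m - mset_set \<sigma>)) ` ?S"
        and nz: "?t x \<noteq> 0"
      obtain a b where ab: "x = (a, b)" "m = a + b" using x by auto
      with nz have *: "mset_set (set_mset a) = a" "b \<notin> I"
        by (auto simp: mcoeff_mu split: if_splits)
      then have "set_mset a \<in> ?S" by (simp add: ab)
      then have "(mset_set (set_mset a), m - mset_set (set_mset a)) \<in>
          (\<lambda>\<sigma>. (mset_set \<sigma>, m - mset_set \<sigma>)) ` ?S" by (rule imageI)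
      with x * show False by (simp add: ab)
    qed
  qed (auto simp: mset_set_subseteq_iff fin)
  also have "\<dots> = (\<Sum>\<sigma>\<in>?S. ?t (mset_set \<sigma>, m - mset_set \<sigma>))"
    using sum.reindex [OF inj, of ?t] by (simp only: comp_def)
  also have "\<dots> = (\<Sum>\<sigma>\<in>?S. (- 1) ^ card \<sigma>)"
    by (rule sum.cong) (auto simp: mcoeff_mu dest: fin)
  also have "?S = Pow (set_mset m) - Delta I m"
    by (auto simp: Delta_def mset_set_subseteq_iff fin)
  finally show ?thesis .
qed

lemma sum_alternating_Pow:
  assumes "finite A" "A \<noteq> {}"
  shows "(\<Sum>\<sigma>\<in>Pow A. (- 1) ^ card \<sigma>) = (0 :: int)"
proof -
  have "card {T. T \<subseteq> A \<and> {} \<subseteq> T \<and> even (card T)} = card {T. T \<subseteq> A \<and> {} \<subseteq> T \<and> odd (card T)}"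
    using assms by (intro card_subsupersets_even_odd) auto
  then show ?thesis using assms by (intro sum_alternating_cancels) (simp_all add: Pow_def)
qed

lemma neg_one_pow_face_dim: "neg_one_pow (face_dim F) = - ((- 1) ^ card F)"
  by (cases "even (card F)") (simp_all add: neg_one_pow_def face_dim_def)

lemma reduced_euler_char_eq_sum_faces:
  assumes "finite \<Delta>"
  shows "reduced_euler_char \<Delta> = (\<Sum>F\<in>\<Delta>. neg_one_pow (face_dim F))"
proof -
  have "reduced_euler_char \<Delta> = (\<Sum>i\<in>face_dim ` \<Delta>. \<Sum>F\<in>faces \<Delta> i. neg_one_pow (face_dim F))"
    by (simp add: reduced_euler_char_def faces_def mult.commute)
  also have "\<dots> = (\<Sum>F\<in>\<Delta>. neg_one_pow (face_dim F))"
    unfolding faces_def by (rule sum.image_gen [OF assms, symmetric])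
  finally show ?thesis .
qed

text \<open>
  The signs of all subsets of a nonempty set cancel, so the signed count of the non-faces is the
  negative of that of the faces. This negative sign is the shift between the cardinality and the
  dimension of a face. For the monomial 1 there is only the empty subset, and nothing cancels.
\<close>

lemma mcoeff_p_series_eq_reduced_euler_char:
  assumes "m \<noteq> {#}"
  shows "mcoeff (p_series I) m = reduced_euler_char (Delta I m)"
proof -
  have "Delta I m \<subseteq> Pow (set_mset m)" by (auto simp: Delta_def mset_set_subseteq_iff)
  then have "mcoeff (p_series I) m =
      (\<Sum>\<sigma>\<in>Pow (set_mset m). (- 1) ^ card \<sigma>) - (\<Sum>\<sigma>\<in>Delta I m. (- 1) ^ card \<sigma>)"
    by (simp add: mcoeff_p_series sum_diff)
  also have "\<dots> = reduced_euler_char (Delta I m)"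
    using assms by (simp add: sum_alternating_Pow reduced_euler_char_eq_sum_faces finite_Delta
        neg_one_pow_face_dim sum_negf)
  finally show ?thesis .
qed

section \<open>Quotients of vector spaces\<close>

text \<open>
  An independent subset of the subspace is independent in the whole space, so its size is bounded
  by the dimension there; hence a maximal one exists, and it is a finite basis of the subspace.
\<close>

lemma (in vectorspace) subspace_fin_dim:
  assumes W: "subspace K W V" and fd: "fin_dim"
  shows "vectorspace.fin_dim K (vs W)"
proof -
  interpret W: vectorspace K "vs W" by (rule subspace_is_vs [OF W])
  have sub: "submodule K W V" using W by simp
  then have WV: "W \<subseteq> carrier V" by (simp add: submodule_def)
  have indpt: "lin_indpt A" if "A \<subseteq> W" "W.lin_indpt A" for A
    using span_li_not_depend(2) [OF that(1) sub] that(2) by simp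
  have "\<exists>A. finite A \<and> maximal A (\<lambda>S. S \<subseteq> carrier (vs W) \<and> W.lin_indpt S)"
  proof (rule maximal_exists)
    show "finite A \<and> card A \<le> dim" if "A \<subseteq> carrier (vs W) \<and> W.lin_indpt A" for A
      using that indpt [of A] li_le_dim [OF fd, of A] WV by auto
    show "{} \<subseteq> carrier (vs W) \<and> W.lin_indpt {}" by (simp add: W.lin_dep_def)
  qed
  then show ?thesis
    using W.max_li_is_basis unfolding W.fin_dim_def W.basis_def by blast
qed

lemma submodule_abelian_subgroup:
  assumes "submodule R W V" shows "abelian_subgroup W V"
proof -
  interpret V: Module.module R V using assms by (simp add: submodule_def)
  interpret W: submodule R W V by (rule assms)
  have neg: "\<ominus>\<^bsub>V\<^esub> a \<in> W" if "a \<in> W" for a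
  proof -
    have "\<ominus>\<^bsub>R\<^esub> \<one>\<^bsub>R\<^esub> \<odot>\<^bsub>V\<^esub> a \<in> W" using that by (intro W.smult_closed) simp_all
    then show ?thesis using that W.subset V.smult_minus_1 [of a] by (metis subsetD)
  qed
  have "subgroup W (add_monoid V)"
    by (rule V.add.subgroupI) (use W.subset W.zero_closed W.m_closed neg in \<open>auto simp del: W.zero_closed\<close>)
  then have "additive_subgroup W V" by (rule additive_subgroup.intro)
  then show ?thesis by (rule abelian_subgroupI3) (rule V.abelian_group_axioms)
qed

text \<open>
  Scalar multiplication on the quotient is well defined: all members of the union on the left are
  the same coset, whichever representative \<open>c\<close> is taken.
\<close>

lemma submodule_r_coset_smult:
  assumes W: "submodule R W V" and a: "a \<in> carrier R" and v: "v \<in> carrier V"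
  shows "(\<Union>c \<in> W +>\<^bsub>V\<^esub> v. W +>\<^bsub>V\<^esub> (a \<odot>\<^bsub>V\<^esub> c)) = W +>\<^bsub>V\<^esub> (a \<odot>\<^bsub>V\<^esub> v)"
proof -
  interpret V: Module.module R V using W by (simp add: submodule_def)
  interpret W: submodule R W V by (rule W)
  interpret A: abelian_subgroup W V by (rule submodule_abelian_subgroup [OF W])
  have "W +>\<^bsub>V\<^esub> (a \<odot>\<^bsub>V\<^esub> c) = W +>\<^bsub>V\<^esub> (a \<odot>\<^bsub>V\<^esub> v)" if c: "c \<in> W +>\<^bsub>V\<^esub> v" for c
  proof -
    obtain w where w: "w \<in> W" "c = w \<oplus>\<^bsub>V\<^esub> v"
      using c unfolding a_r_coset_def' by auto
    have wV: "w \<in> carrier V" using w(1) W.subset by auto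
    have aw: "a \<odot>\<^bsub>V\<^esub> w \<in> W" using a w by simp
    have "a \<odot>\<^bsub>V\<^esub> c = a \<odot>\<^bsub>V\<^esub> w \<oplus>\<^bsub>V\<^esub> a \<odot>\<^bsub>V\<^esub> v"
      using a v wV w(2) by (simp add: V.smult_r_distr)
    then have "a \<odot>\<^bsub>V\<^esub> c \<in> W +>\<^bsub>V\<^esub> (a \<odot>\<^bsub>V\<^esub> v)" 
      using aw unfolding a_r_coset_def' by auto
    then show ?thesis
      using V.a_repr_independence [OF _ V.smult_closed [OF a v] A.a_subgroup] by simp
  qed
  moreover have "v \<in> W +>\<^bsub>V\<^esub> v" using v by (rule A.a_rcos_self)
  ultimately show ?thesis by blast
qed

lemma quotient_map_linear:
  fixes V :: "('k, 'a) module"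
  assumes V: "vectorspace K V" and W: "submodule K W V"
  shows "linear_map K V (quotient_module V W) (\<lambda>v. W +>\<^bsub>V\<^esub> v)"
proof -
  interpret V: vectorspace K V by (rule V)
  interpret W: submodule K W V by (rule W)
  interpret A: abelian_subgroup W V by (rule submodule_abelian_subgroup [OF W])
  let ?Q = "quotient_module V W"
  have carrier: "carrier ?Q = (\<lambda>v. W +>\<^bsub>V\<^esub> v) ` carrier V"
    by (auto simp: quotient_module_def A_RCOSETS_def')
  have zero: "\<zero>\<^bsub>?Q\<^esub> = W +>\<^bsub>V\<^esub> \<zero>\<^bsub>V\<^esub>"
    using W.subset by (simp add: quotient_module_def V.a_coset_add_zero)
  have add: "(W +>\<^bsub>V\<^esub> v) \<oplus>\<^bsub>?Q\<^esub> (W +>\<^bsub>V\<^esub> w) = W +>\<^bsub>V\<^esub> (v \<oplus>\<^bsub>V\<^esub> w)"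
    if "v \<in> carrier V" "w \<in> carrier V" for v w
    using that by (simp add: quotient_module_def A.a_rcos_sum)
  have smult: "a \<odot>\<^bsub>?Q\<^esub> (W +>\<^bsub>V\<^esub> v) = W +>\<^bsub>V\<^esub> (a \<odot>\<^bsub>V\<^esub> v)"
    if "a \<in> carrier K" "v \<in> carrier V" for a v
    using that by (simp add: quotient_module_def submodule_r_coset_smult [OF W])
  have "vectorspace K ?Q"
  proof (rule vs_criteria)
    show "field K" by (rule V.field_axioms)
    show "\<forall>v\<in>carrier ?Q. \<exists>u\<in>carrier ?Q. v \<oplus>\<^bsub>?Q\<^esub> u = \<zero>\<^bsub>?Q\<^esub>"
    proof
      fix C assume "C \<in> carrier ?Q"
      then obtain v where v: "v \<in> carrier V" "C = W +>\<^bsub>V\<^esub> v" by (auto simp: carrier)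
      then have "C \<oplus>\<^bsub>?Q\<^esub> (W +>\<^bsub>V\<^esub> (\<ominus>\<^bsub>V\<^esub> v)) = \<zero>\<^bsub>?Q\<^esub>"
        by (simp add: add zero V.r_neg)
      then show "\<exists>u\<in>carrier ?Q. C \<oplus>\<^bsub>?Q\<^esub> u = \<zero>\<^bsub>?Q\<^esub>"
        using v by (auto simp: carrier)
    qed
    show "\<zero>\<^bsub>?Q\<^esub> \<in> carrier ?Q" by (simp only: carrier zero imageI V.zero_closed)
    show "\<forall>v\<in>carrier ?Q. v \<oplus>\<^bsub>?Q\<^esub> \<zero>\<^bsub>?Q\<^esub> = v"
    proof
      fix C assume "C \<in> carrier ?Q"
      then obtain v where v: "v \<in> carrier V" "C = W +>\<^bsub>V\<^esub> v" by (auto simp: carrier)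
      show "C \<oplus>\<^bsub>?Q\<^esub> \<zero>\<^bsub>?Q\<^esub> = C"
        unfolding v(2) zero add [OF v(1) V.zero_closed] using v(1) by simp
    qed
  qed (auto simp: carrier add smult V.a_ac V.smult_l_distr V.smult_r_distr V.smult_assoc1)
  moreover have "(\<lambda>v. W +>\<^bsub>V\<^esub> v) \<in> module_hom K V ?Q"
    by (auto simp: module_hom_def carrier add smult)
  ultimately show ?thesis
    using V by (simp add: linear_map_def mod_hom_def mod_hom_axioms_def vectorspace_def)
qed

text \<open>
  This is the rank-nullity theorem for the canonical projection, whose kernel is \<open>W\<close>.
\<close>

lemma dim_quotient_module:
  fixes V :: "('k, 'a) module"
  assumes V: "vectorspace K V" and W: "submodule K W V" and fd: "vectorspace.fin_dim K V"
  shows "vectorspace.dim K (quotient_module V W) + vectorspace.dim K (V\<lparr>carrier := W\<rparr>)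
    = vectorspace.dim K V"
proof -
  interpret V: vectorspace K V by (rule V)
  interpret A: abelian_subgroup W V by (rule submodule_abelian_subgroup [OF W])
  interpret q: linear_map K V "quotient_module V W" "\<lambda>v. W +>\<^bsub>V\<^esub> v"
    by (rule quotient_map_linear [OF V W])
  have zero: "\<zero>\<^bsub>quotient_module V W\<^esub> = W"
    by (simp add: quotient_module_def)
  have "carrier (quotient_module V W) = (\<lambda>v. W +>\<^bsub>V\<^esub> v) ` carrier V"
    by (simp add: quotient_module_def A_RCOSETS_def' UNION_singleton_eq_range)
  then have "q.im = carrier (quotient_module V W)"
    unfolding q.im_def by simp
  moreover have "q.ker = W"
  proof
    show "q.ker \<subseteq> W"
      unfolding q.ker_def zero using A.a_rcos_self by fastforce
    show "W \<subseteq> q.ker"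
      unfolding q.ker_def zero using A.a_rcos_const A.a_subset by fastforce
  qed
  ultimately show ?thesis using q.rank_nullity [OF fd] by simp
qed

section \<open>The augmented chain complex\<close>

lemma carrier_chain_module:
  "c \<in> carrier (chain_module \<Delta> i) \<longleftrightarrow> finite {\<sigma>. c \<sigma> \<noteq> 0} \<and> {\<sigma>. c \<sigma> \<noteq> 0} \<subseteq> faces \<Delta> i"
  by (simp add: chain_module_def)

lemma chain_module_simps [simp]:
  "\<zero>\<^bsub>chain_module \<Delta> i\<^esub> = (\<lambda>\<sigma>. 0)"
  "c \<oplus>\<^bsub>chain_module \<Delta> i\<^esub> d = (\<lambda>\<sigma>. c \<sigma> + d \<sigma>)"
  "a \<odot>\<^bsub>chain_module \<Delta> i\<^esub> c = (\<lambda>\<sigma>. a * c \<sigma>)"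
  by (simp_all add: chain_module_def)

lemma chain_add_closed:
  assumes "c \<in> carrier (chain_module \<Delta> i)" "d \<in> carrier (chain_module \<Delta> i)"
  shows "(\<lambda>\<sigma>. c \<sigma> + d \<sigma>) \<in> carrier (chain_module \<Delta> i)"
proof -
  have "{\<sigma>. c \<sigma> + d \<sigma> \<noteq> 0} \<subseteq> {\<sigma>. c \<sigma> \<noteq> 0} \<union> {\<sigma>. d \<sigma> \<noteq> 0}" by auto
  moreover from this have "finite {\<sigma>. c \<sigma> + d \<sigma> \<noteq> 0}"
    using assms by (auto simp: carrier_chain_module intro: finite_subset)
  ultimately show ?thesis using assms by (auto simp: carrier_chain_module)
qed

lemma chain_smult_closed:
  assumes "c \<in> carrier (chain_module \<Delta> i)"
  shows "(\<lambda>\<sigma>. a * c \<sigma>) \<in> carrier (chain_module \<Delta> i)"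
  using assms by (cases "a = 0") (auto simp: carrier_chain_module)

lemma vectorspace_chain_module:
  "vectorspace class_ring (chain_module \<Delta> i :: ('k::field, _) module)"
proof (rule vs_criteria)
  let ?C = "chain_module \<Delta> i :: ('k, _) module"
  show "\<forall>c\<in>carrier ?C. \<exists>d\<in>carrier ?C. c \<oplus>\<^bsub>?C\<^esub> d = \<zero>\<^bsub>?C\<^esub>"
  proof
    fix c assume "c \<in> carrier ?C"
    then have "(\<lambda>\<sigma>. - 1 * c \<sigma>) \<in> carrier ?C" by (rule chain_smult_closed)
    then show "\<exists>d\<in>carrier ?C. c \<oplus>\<^bsub>?C\<^esub> d = \<zero>\<^bsub>?C\<^esub>" by (rule bexI [rotated]) simp
  qed
  show "\<zero>\<^bsub>?C\<^esub> \<in> carrier ?C" by (simp add: carrier_chain_module)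
qed (auto simp: class_field chain_add_closed chain_smult_closed algebra_simps)

lemma finsum_chain_module:
  assumes "finite A" "f \<in> A \<rightarrow> carrier (chain_module \<Delta> i :: ('k::field, _) module)"
  shows "finsum (chain_module \<Delta> i) f A = (\<lambda>\<sigma>. \<Sum>x\<in>A. f x \<sigma>)"
proof -
  interpret C: vectorspace class_ring "chain_module \<Delta> i :: ('k::field, _) module"
    by (rule vectorspace_chain_module)
  from assms show ?thesis
    by (induction A) (simp_all add: C.finsum_insert)
qed

definition elementary_chain :: "nat set \<Rightarrow> nat set \<Rightarrow> 'k::field" where
  "elementary_chain \<sigma> = (\<lambda>\<tau>. if \<tau> = \<sigma> then 1 else 0)"

lemma inj_elementary_chain: "inj_on (elementary_chain :: _ \<Rightarrow> _ \<Rightarrow> 'k::field) F"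
proof (rule inj_onI)
  fix \<sigma> \<tau> assume "(elementary_chain \<sigma> :: _ \<Rightarrow> 'k) = elementary_chain \<tau>"
  then have "(elementary_chain \<sigma> \<sigma> :: 'k) = elementary_chain \<tau> \<sigma>" by simp
  then show "\<sigma> = \<tau>" by (simp add: elementary_chain_def split: if_splits)
qed

text \<open>
  A chain is determined by its coefficients, so the elementary chains of the faces form a basis.
\<close>

lemma dim_chain_module:
  assumes fin: "finite (faces \<Delta> i)"
  shows "vectorspace.fin_dim class_ring (chain_module \<Delta> i :: ('k::field, _) module)"
    and "vectorspace.dim class_ring (chain_module \<Delta> i :: ('k::field, _) module) = card (faces \<Delta> i)"
proof -
  let ?C = "chain_module \<Delta> i :: ('k, _) module" and ?F = "faces \<Delta> i"
  let ?e = "elementary_chain :: nat set \<Rightarrow> nat set \<Rightarrow> 'k"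
  let ?B = "?e ` ?F"
  interpret C: vectorspace class_ring ?C by (rule vectorspace_chain_module)
  have BC: "?B \<subseteq> carrier ?C"
    by (auto simp: carrier_chain_module elementary_chain_def)
  have lincomb: "C.lincomb a ?B = (\<lambda>\<tau>. if \<tau> \<in> ?F then a (?e \<tau>) else 0)" for a
  proof -
    have "C.lincomb a ?B = (\<lambda>\<tau>. \<Sum>b\<in>?B. a b * b \<tau>)"
      unfolding C.lincomb_def using fin BC
      by (subst finsum_chain_module) (auto intro: chain_smult_closed)
    also have "\<dots> = (\<lambda>\<tau>. \<Sum>\<sigma>\<in>?F. if \<tau> = \<sigma> then a (?e \<sigma>) else 0)"
      by (subst sum.reindex [OF inj_elementary_chain])
        (auto simp: elementary_chain_def intro!: ext sum.cong)
    finally show ?thesis using fin by simp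
  qed
  have "C.basis ?B"
  proof (subst C.basis_criterion, goal_cases)
    case 3
    show ?case
    proof (intro allI impI)
      fix c assume c: "c \<in> carrier ?C"
      let ?a = "\<lambda>b\<in>?B. c (inv_into ?F ?e b)"
      have a: "?a (?e \<tau>) = c \<tau>" if "\<tau> \<in> ?F" for \<tau>
        using that by (simp add: inv_into_f_f [OF inj_elementary_chain])
      have supp: "c \<tau> = 0" if "\<tau> \<notin> ?F" for \<tau>
        using c that by (auto simp: carrier_chain_module)
      show "\<exists>!a. a \<in> ?B \<rightarrow>\<^sub>E carrier class_ring \<and> C.lincomb a ?B = c"
      proof (rule ex1I)
        show "?a \<in> ?B \<rightarrow>\<^sub>E carrier class_ring \<and> C.lincomb ?a ?B = c"
          unfolding lincomb using a supp by auto
        fix a assume *: "a \<in> ?B \<rightarrow>\<^sub>E carrier class_ring \<and> C.lincomb a ?B = c"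
        then have "a (?e \<tau>) = c \<tau>" if "\<tau> \<in> ?F" for \<tau>
          using that fun_cong [of _ c \<tau>] unfolding lincomb by fastforce
        with * a show "a = ?a"
          by (intro PiE_ext [of a ?B "\<lambda>_. UNIV" ?a]) auto
      qed
    qed
  qed (use fin BC in auto)
  with fin BC show "C.fin_dim" unfolding C.fin_dim_def C.basis_def by (intro exI [of _ ?B]) simp
  have "C.dim = card ?B" using C.dim_basis [OF finite_imageI [OF fin] \<open>C.basis ?B\<close>] .
  also have "\<dots> = card ?F" by (rule card_image [OF inj_elementary_chain])
  finally show "C.dim = card ?F" .
qed

text \<open>
  The dual description of the boundary, by the simplices that have \<open>\<tau>\<close> as a facet: each of them is
  \<open>insert v \<tau>\<close> for a unique vertex \<open>v\<close> outside \<open>\<tau>\<close>, and the position of \<open>v\<close> in it can be read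
  off from \<open>\<tau>\<close>. The index set no longer depends on the support of \<open>c\<close>, only on a finite vertex
  set \<open>V\<close> that contains all simplices of \<open>c\<close>. This makes linearity immediate and turns the
  iterated boundary into a sum over pairs of vertices.
\<close>

lemma boundary_sum_cofaces:
  assumes fin: "finite V" and supp: "{\<sigma>. c \<sigma> \<noteq> 0} \<subseteq> Pow V"
  shows "boundary c \<tau> = (\<Sum>v\<in>V - \<tau>. (- 1) ^ card {w \<in> \<tau>. w < v} * c (insert v \<tau>))"
proof -
  let ?s = "\<lambda>\<sigma> v. (- 1) ^ card {w \<in> \<sigma>. w < v} * c \<sigma>"
  have "boundary c \<tau> = (\<Sum>\<sigma>\<in>Pow V. \<Sum>v\<in>\<sigma>. if \<sigma> - {v} = \<tau> then ?s \<sigma> v else 0)"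
    unfolding boundary_def using fin supp
    by (intro sum.mono_neutral_left) (auto intro!: sum.neutral)
  also have "\<dots> = (\<Sum>\<sigma>\<in>Pow V. \<Sum>v\<in>V. if v \<in> \<sigma> \<and> \<sigma> - {v} = \<tau> then ?s \<sigma> v else 0)"
    by (rule sum.cong [OF refl], rule sum.mono_neutral_cong_left) (use fin in auto)
  also have "\<dots> = (\<Sum>v\<in>V. \<Sum>\<sigma>\<in>Pow V. if v \<in> \<sigma> \<and> \<sigma> - {v} = \<tau> then ?s \<sigma> v else 0)"
    by (rule sum.swap)
  also have "\<dots> = (\<Sum>v\<in>V. if v \<in> \<tau> then 0 else (- 1) ^ card {w \<in> \<tau>. w < v} * c (insert v \<tau>))"
  proof (rule sum.cong [OF refl])
    fix v assume "v \<in> V"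
    have "(\<Sum>\<sigma>\<in>Pow V. if v \<in> \<sigma> \<and> \<sigma> - {v} = \<tau> then ?s \<sigma> v else 0) =
        (\<Sum>\<sigma>\<in>Pow V. if \<sigma> = insert v \<tau> then if v \<in> \<tau> then 0 else ?s \<sigma> v else 0)"
      by (rule sum.cong) auto
    also have "\<dots> = (if v \<in> \<tau> then 0 else ?s (insert v \<tau>) v)"
      using fin supp by (auto simp: sum.delta)
    also have "{w \<in> insert v \<tau>. w < v} = {w \<in> \<tau>. w < v}" by auto
    finally show "(\<Sum>\<sigma>\<in>Pow V. if v \<in> \<sigma> \<and> \<sigma> - {v} = \<tau> then ?s \<sigma> v else 0) =
        (if v \<in> \<tau> then 0 else (- 1) ^ card {w \<in> \<tau>. w < v} * c (insert v \<tau>))" by simp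
  qed
  also have "\<dots> = (\<Sum>v\<in>V - \<tau>. (- 1) ^ card {w \<in> \<tau>. w < v} * c (insert v \<tau>))"
    using fin by (intro sum.mono_neutral_cong_right) auto
  finally show ?thesis .
qed

lemma boundary_support:
  assumes fin: "finite V" and supp: "{\<sigma>. c \<sigma> \<noteq> 0} \<subseteq> Pow V" and nz: "boundary c \<tau> \<noteq> 0"
  obtains v where "v \<in> V" "v \<notin> \<tau>" "c (insert v \<tau>) \<noteq> 0"
proof -
  from nz obtain v where "v \<in> V - \<tau>" "(- 1) ^ card {w \<in> \<tau>. w < v} * c (insert v \<tau>) \<noteq> 0"
    unfolding boundary_sum_cofaces [OF fin supp] by (rule sum.not_neutral_contains_not_neutral)
  then show thesis using that by auto
qed

text \<open>
  The coefficient of the iterated boundary at \<open>\<rho>\<close> is a sum over ordered pairs \<open>(v, w)\<close> of distinct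
  vertices outside \<open>\<rho>\<close> that are added to \<open>\<rho>\<close>. Of the two orders of insertion, one passes the
  smaller vertex when the sign of the larger one is determined, and the other does not; the two
  terms have opposite signs and cancel.
\<close>

lemma boundary_boundary:
  assumes fin: "finite V" and supp: "{\<sigma>. c \<sigma> \<noteq> 0} \<subseteq> Pow V"
  shows "boundary (boundary c) = (\<lambda>\<rho>. 0)"
proof
  fix \<rho>
  let ?s = "\<lambda>\<tau> v. (- 1) ^ card {w \<in> \<tau>. w < v} :: 'a"
  let ?t = "\<lambda>(v, w). ?s \<rho> v * (?s (insert v \<rho>) w * c (insert w (insert v \<rho>)))"
  define P where "P = {(v, w). v \<in> V - \<rho> \<and> w \<in> V - \<rho> \<and> v < w}"
  define Q where "Q = {(v, w). v \<in> V - \<rho> \<and> w \<in> V - \<rho> \<and> w < v}"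
  have finPQ: "finite P" "finite Q"
    using fin by (auto simp: P_def Q_def intro: finite_subset [of _ "V \<times> V"])
  have supp': "{\<tau>. boundary c \<tau> \<noteq> 0} \<subseteq> Pow V"
  proof
    fix \<tau> assume "\<tau> \<in> {\<tau>. boundary c \<tau> \<noteq> 0}"
    then obtain v where "c (insert v \<tau>) \<noteq> 0" using boundary_support [OF fin supp] by blast
    then show "\<tau> \<in> Pow V" using supp by blast
  qed
  have "boundary (boundary c) \<rho> = (\<Sum>v\<in>V - \<rho>. \<Sum>w\<in>V - insert v \<rho>. ?t (v, w))"
    unfolding boundary_sum_cofaces [OF fin supp'] boundary_sum_cofaces [OF fin supp]
    by (simp add: sum_distrib_left)
  also have "\<dots> = sum ?t (Sigma (V - \<rho>) (\<lambda>v. V - insert v \<rho>))"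
    using fin by (subst sum.Sigma) auto
  also have "Sigma (V - \<rho>) (\<lambda>v. V - insert v \<rho>) = P \<union> Q"
    by (auto simp: P_def Q_def)
  also have "sum ?t (P \<union> Q) = sum ?t P + sum ?t Q"
    using finPQ by (intro sum.union_disjoint) (auto simp: P_def Q_def)
  also have "sum ?t Q = (\<Sum>x\<in>P. - ?t x)"
  proof (rule sum.reindex_bij_witness [of _ prod.swap prod.swap])
    fix x assume x: "x \<in> Q"
    obtain v w where vw: "x = (v, w)" by (cases x)
    with x have *: "v \<notin> \<rho>" "w \<notin> \<rho>" "w < v" by (auto simp: Q_def)
    have "{u \<in> insert v \<rho>. u < w} = {u \<in> \<rho>. u < w}" using * by auto
    moreover have "{u \<in> insert w \<rho>. u < v} = insert w {u \<in> \<rho>. u < v}" using * by auto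
    ultimately show "- ?t (prod.swap x) = ?t x"
      using * by (simp add: vw insert_commute mult_ac)
  qed (auto simp: P_def Q_def)
  finally show "boundary (boundary c) \<rho> = 0" by (simp add: sum_negf)
qed

lemma chain_vertices:
  assumes \<Delta>: "simplicial_complex \<Delta>" and c: "c \<in> carrier (chain_module \<Delta> i)"
  obtains V where "finite V" "{\<sigma>. c \<sigma> \<noteq> 0} \<subseteq> Pow V"
proof
  show "finite (\<Union>{\<sigma>. c \<sigma> \<noteq> 0})"
    using assms by (auto simp: carrier_chain_module faces_def simplicial_complex_def)
qed auto

lemma boundary_closed:
  assumes \<Delta>: "simplicial_complex \<Delta>" and c: "c \<in> carrier (chain_module \<Delta> i)"
  shows "boundary c \<in> carrier (chain_module \<Delta> (i - 1))"
proof -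
  obtain V where V: "finite V" "{\<sigma>. c \<sigma> \<noteq> 0} \<subseteq> Pow V"
    using chain_vertices [OF assms] by blast
  have *: "\<tau> \<in> faces \<Delta> (i - 1) \<inter> Pow V" if nz: "boundary c \<tau> \<noteq> 0" for \<tau>
  proof -
    obtain v where v: "v \<notin> \<tau>" "c (insert v \<tau>) \<noteq> 0"
      using boundary_support [OF V nz] by blast
    then have "insert v \<tau> \<in> \<Delta>" and dim: "face_dim (insert v \<tau>) = i"
      using c by (auto simp: carrier_chain_module faces_def)
    then have "\<tau> \<in> \<Delta>" and "finite \<tau>"
      using \<Delta> by (auto simp: simplicial_complex_def)
    with dim v V(2) show ?thesis by (auto simp: faces_def face_dim_def)
  qed
  moreover have "finite {\<tau>. boundary c \<tau> \<noteq> 0}"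
    by (rule finite_subset [of _ "Pow V"]) (use * V(1) in auto)
  ultimately show ?thesis by (auto simp: carrier_chain_module)
qed

lemma boundary_linear:
  assumes \<Delta>: "simplicial_complex \<Delta>"
  shows "linear_map class_ring (chain_module \<Delta> i) (chain_module \<Delta> (i - 1))
    (boundary :: (nat set \<Rightarrow> 'k::field) \<Rightarrow> _)"
proof -
  let ?C = "chain_module \<Delta> :: int \<Rightarrow> ('k, _) module"
  have C: "vectorspace class_ring (?C j)" for j by (rule vectorspace_chain_module)
  have "boundary (\<lambda>\<sigma>. c \<sigma> + d \<sigma>) = (\<lambda>\<sigma>. boundary c \<sigma> + boundary d \<sigma>)"
    if cd: "c \<in> carrier (?C i)" "d \<in> carrier (?C i)" for c d
  proof
    fix \<tau>
    obtain U where U: "finite U" "{\<sigma>. c \<sigma> \<noteq> 0} \<subseteq> Pow U"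
      using chain_vertices [OF \<Delta> cd(1)] by blast
    obtain V where V: "finite V" "{\<sigma>. d \<sigma> \<noteq> 0} \<subseteq> Pow V"
      using chain_vertices [OF \<Delta> cd(2)] by blast
    have fin: "finite (U \<union> V)" using U(1) V(1) by simp
    have supp: "{\<sigma>. c \<sigma> \<noteq> 0} \<subseteq> Pow (U \<union> V)" "{\<sigma>. d \<sigma> \<noteq> 0} \<subseteq> Pow (U \<union> V)"
      using U(2) V(2) by blast+
    moreover have "{\<sigma>. c \<sigma> + d \<sigma> \<noteq> 0} \<subseteq> {\<sigma>. c \<sigma> \<noteq> 0} \<union> {\<sigma>. d \<sigma> \<noteq> 0}" by auto
    ultimately have "{\<sigma>. c \<sigma> + d \<sigma> \<noteq> 0} \<subseteq> Pow (U \<union> V)" by blast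
    then show "boundary (\<lambda>\<sigma>. c \<sigma> + d \<sigma>) \<tau> = boundary c \<tau> + boundary d \<tau>"
      unfolding boundary_sum_cofaces [OF fin supp(1)] boundary_sum_cofaces [OF fin supp(2)]
      by (simp add: boundary_sum_cofaces [OF fin] distrib_left sum.distrib)
  qed
  moreover have "boundary (\<lambda>\<sigma>. a * c \<sigma>) = (\<lambda>\<sigma>. a * boundary c \<sigma>)"
    if c: "c \<in> carrier (?C i)" for a c
  proof
    fix \<tau>
    obtain V where V: "finite V" "{\<sigma>. c \<sigma> \<noteq> 0} \<subseteq> Pow V"
      using chain_vertices [OF \<Delta> c] by blast
    moreover have "{\<sigma>. a * c \<sigma> \<noteq> 0} \<subseteq> Pow V" using V(2) by auto
    ultimately show "boundary (\<lambda>\<sigma>. a * c \<sigma>) \<tau> = a * boundary c \<tau>"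
      by (simp add: boundary_sum_cofaces [OF V(1)] sum_distrib_left mult_ac)
  qed
  ultimately have "boundary \<in> module_hom class_ring (?C i) (?C (i - 1))"
    by (auto simp: module_hom_def boundary_closed [OF \<Delta>])
  then show ?thesis
    using C [of i] C [of "i - 1"]
    by (simp add: linear_map_def mod_hom_def mod_hom_axioms_def vectorspace_def)
qed

section \<open>The Euler-Poincare formula\<close>

lemma submodule_restrict:
  assumes "submodule R W V" "submodule R Z V" "W \<subseteq> Z"
  shows "submodule R W (V\<lparr>carrier := Z\<rparr>)"
proof -
  interpret V: Module.module R V using assms(1) by (simp add: submodule_def)
  have "Module.module R (V\<lparr>carrier := Z\<rparr>)" by (rule V.submodule_is_module [OF assms(2)])
  with assms show ?thesis by (simp add: submodule_def)
qed

lemma boundaries_subset_cycles: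
  assumes \<Delta>: "simplicial_complex \<Delta>"
  shows "boundaries \<Delta> i \<subseteq> cycles \<Delta> i"
proof
  fix b assume "b \<in> boundaries \<Delta> i"
  then obtain c where c: "c \<in> carrier (chain_module \<Delta> (i + 1))" and b: "b = boundary c"
    by (auto simp: boundaries_def)
  obtain V where "finite V" "{\<sigma>. c \<sigma> \<noteq> 0} \<subseteq> Pow V" using chain_vertices [OF \<Delta> c] by blast
  then show "b \<in> cycles \<Delta> i"
    using boundary_closed [OF \<Delta> c] boundary_boundary by (simp add: cycles_def b)
qed

text \<open>
  With \<open>f\<^sub>i\<close>, \<open>z\<^sub>i\<close>, \<open>b\<^sub>i\<close>, \<open>h\<^sub>i\<close> the dimensions of the chains, cycles, boundaries and homology in
  degree \<open>i\<close>, the boundary map gives \<open>b\<^sub>i\<^sub>-\<^sub>1 + z\<^sub>i = f\<^sub>i\<close> and the quotient gives \<open>h\<^sub>i + b\<^sub>i = z\<^sub>i\<close>.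
\<close>

lemma dim_reduced_homology:
  fixes \<Delta> :: "nat set set" and i :: int
  defines "C \<equiv> chain_module \<Delta> :: int \<Rightarrow> ('k::field, nat set \<Rightarrow> 'k) module"
  defines "b \<equiv> \<lambda>j. vectorspace.dim class_ring ((C j)\<lparr>carrier := boundaries \<Delta> j\<rparr>)"
  assumes \<Delta>: "simplicial_complex \<Delta>" and fin: "finite \<Delta>"
  shows "vectorspace.dim class_ring (reduced_homology \<Delta> i :: ('k, _) module) + b i + b (i - 1)
    = card (faces \<Delta> i)"
proof -
  interpret d: linear_map class_ring "C i" "C (i - 1)" boundary
    unfolding C_def by (rule boundary_linear [OF \<Delta>])
  interpret d': linear_map class_ring "C (i + 1)" "C (i + 1 - 1)" boundary
    unfolding C_def by (rule boundary_linear [OF \<Delta>])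
  have finite_faces: "finite (faces \<Delta> i)" using fin by (simp add: faces_def)
  have fd: "d.V.fin_dim" and dim: "d.V.dim = card (faces \<Delta> i)"
    using dim_chain_module [OF finite_faces] unfolding C_def by auto
  have ker: "d.ker = cycles \<Delta> i" and im: "d.im = boundaries \<Delta> (i - 1)"
    and im': "d'.im = boundaries \<Delta> i"
    unfolding d.ker_def d.im_def d'.im_def by (simp_all add: cycles_def boundaries_def C_def)
  have Z: "subspace class_ring (cycles \<Delta> i) (C i)"
    using d.kerT_is_subspace unfolding ker .
  have "submodule class_ring (boundaries \<Delta> i) (C i)"
    using d'.im_is_submodule unfolding im' by simp
  then have B: "submodule class_ring (boundaries \<Delta> i) ((C i)\<lparr>carrier := cycles \<Delta> i\<rparr>)"
    by (rule submodule_restrict) (use Z boundaries_subset_cycles [OF \<Delta>] in auto)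
  have "vectorspace.dim class_ring (reduced_homology \<Delta> i :: ('k, _) module) + b i =
      vectorspace.dim class_ring ((C i)\<lparr>carrier := cycles \<Delta> i\<rparr>)"
    using dim_quotient_module [OF d.V.subspace_is_vs [OF Z] B d.V.subspace_fin_dim [OF Z fd]]
    by (simp add: reduced_homology_def b_def C_def)
  then show ?thesis
    using d.rank_nullity [OF fd] unfolding ker im dim by (simp add: b_def)
qed

lemma alternating_telescope:
  "(\<Sum>i\<in>{-1..int n}. neg_one_pow i * (b i + b (i - 1))) = neg_one_pow (int n) * b (int n) - b (- 2)"
proof (induction n)
  case 0
  have "{-1..int 0} = {-1, 0}" by auto
  then show ?case by (simp add: neg_one_pow_def)
next
  case (Suc n)
  have "{-1..int (Suc n)} = insert (int (Suc n)) {-1..int n}" by auto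
  with Suc show ?case by (simp add: neg_one_pow_def algebra_simps)
qed

text \<open>
  The contributions of the boundaries to the alternating sum of the face numbers telescope. All
  dimensions vanish in degrees outside the range of the dimensions of the faces, so nothing is left
  over at the two ends, and the sum over all degrees from \<open>-1\<close> on is a finite one.
\<close>

lemma euler_poincare:
  assumes \<Delta>: "simplicial_complex \<Delta>" and fin: "finite \<Delta>"
  shows "((\<lambda>i. neg_one_pow i *
      int (vectorspace.dim class_ring (reduced_homology \<Delta> i :: ('k::field, _) module)))
    has_sum reduced_euler_char \<Delta>) {-1..}"
proof -
  define h where "h = (\<lambda>i. int (vectorspace.dim class_ring (reduced_homology \<Delta> i :: ('k, _) module)))"
  define b where "b = (\<lambda>i. int (vectorspace.dim class_ring
    ((chain_module \<Delta> i :: ('k, _) module)\<lparr>carrier := boundaries \<Delta> i\<rparr>)))"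
  define f where "f = (\<lambda>i. int (card (faces \<Delta> i)))"
  have h: "h i + (b i + b (i - 1)) = f i" for i
    using dim_reduced_homology [OF assms, of i, where 'k = 'k] unfolding h_def b_def f_def by linarith
  have nonneg: "h i \<ge> 0" "b i \<ge> 0" for i by (simp_all add: h_def b_def)
  obtain N where N: "\<And>F. F \<in> \<Delta> \<Longrightarrow> card F \<le> N"
    using fin by (metis finite_imageI finite_nat_set_iff_bounded_le image_eqI)
  have range: "face_dim ` \<Delta> \<subseteq> {-1..int N}" using N by (force simp: face_dim_def)
  have f0: "f i = 0" if "i \<notin> face_dim ` \<Delta>" for i
  proof -
    have "faces \<Delta> i = {}" using that by (auto simp: faces_def)
    then show ?thesis by (simp add: f_def)
  qed
  have vanish: "h i = 0" "b i = 0" "b (i - 1) = 0" if "i \<notin> {-1..int N}" for i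
  proof -
    have "f i = 0" by (rule f0) (use that range in blast)
    then show "h i = 0" "b i = 0" "b (i - 1) = 0"
      using h [of i] nonneg(1) [of i] nonneg(2) [of i] nonneg(2) [of "i - 1"] by linarith+
  qed
  have "reduced_euler_char \<Delta> = (\<Sum>i\<in>face_dim ` \<Delta>. neg_one_pow i * f i)"
    by (simp add: reduced_euler_char_def f_def)
  also have "\<dots> = (\<Sum>i\<in>{-1..int N}. neg_one_pow i * f i)"
    by (rule sum.mono_neutral_left) (use range f0 in auto)
  also have "\<dots> = (\<Sum>i\<in>{-1..int N}. neg_one_pow i * h i) +
      (\<Sum>i\<in>{-1..int N}. neg_one_pow i * (b i + b (i - 1)))"
    by (simp add: h [symmetric] distrib_left sum.distrib)
  \<comment> \<open>The boundaries in degree \<open>N\<close> come from chains of degree \<open>N + 1\<close>, of which there are none.\<close>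
  also have "(\<Sum>i\<in>{-1..int N}. neg_one_pow i * (b i + b (i - 1))) = 0"
    using vanish(2) [of "- 2"] vanish(3) [of "int N + 1"] by (simp add: alternating_telescope)
  finally have sum: "reduced_euler_char \<Delta> = (\<Sum>i\<in>{-1..int N}. neg_one_pow i * h i)" by simp
  have "((\<lambda>i. neg_one_pow i * h i) has_sum reduced_euler_char \<Delta>) {-1..}"
    unfolding sum by (rule has_sum_finite_neutralI) (use vanish(1) in auto)
  then show ?thesis by (simp only: h_def)
qed

section \<open>The theorem\<close>

theorem theorem4p7:
  fixes I :: "nat multiset set" and m :: "nat multiset"
  assumes "monoid_ideal I"
  shows "finite (Delta I m) \<and>
    (m \<noteq> {#} \<longrightarrow> mcoeff (p_series I) m = reduced_euler_char (Delta I m)) \<and>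
    reduced_euler_char (Delta I m) = (\<Sum>F\<in>Delta I m. neg_one_pow (int (card F) - 1)) \<and>
    ((\<lambda>i::int. neg_one_pow i *
        int (vectorspace.dim (class_ring :: 'k::field_char_0 ring)
          (reduced_homology (Delta I m) i)))
      has_sum reduced_euler_char (Delta I m)) {-1..}"
proof (intro conjI impI)
  show "finite (Delta I m)" by (rule finite_Delta)
  then show "reduced_euler_char (Delta I m) = (\<Sum>F\<in>Delta I m. neg_one_pow (int (card F) - 1))"
    by (simp add: reduced_euler_char_eq_sum_faces face_dim_def)
qed (simp_all add: mcoeff_p_series_eq_reduced_euler_char
    euler_poincare [OF simplicial_complex_Delta [OF assms] finite_Delta])

end
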